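(* Let $G$ be a bigraph that is left-cut-percolating under a set $S$ of folds of $G$. If $c:E(G)\to C$ is a coloring of $G$ that is invariant under the subgroup of $\mathrm{Aut}(G)$ generated by $\{\phi : (\phi,L)\in S\}$ (i.e., $c(\sigma(v),\sigma(w))=c(v,w)$ for every $\sigma$ in this subgroup and every $(v,w)\in E(G)$), then the colored bigraph $(G,c)$ is left-weakly Hölder.
   Context: A bigraph is a triple $G=(V_1,V_2,E)$ with $V_1,V_2$ disjoint finite sets and $E\subseteq V_1\times V_2$; write $V_i(G)=V_i$, $v_i(G)=|V_i|$, $E(G)=E$, $V(G)=V_1\cup V_2$. An automorphism of $G$ is a bijection of $V(G)$ preserving $V_1(G)$, $V_2(G)$, edges and non-edges; $\mathrm{Aut}(G)$ is the group of automorphisms. For $U\subseteq V(G)$, $G|_U$ is the induced subgraph and $G-U=G|_{V(G)\setminus U}$. Folds. A cut-involution of $G$ is an automorphism $\phi$ of $G$ with $\phi=\phi^{-1}$ such that, with $\mathrm{Fix}(\phi)$ the set of vertices fixed by $\phi$, the bigraph $G-\mathrm{Fix}(\phi)$ is disconnected. A fold of $G$ is a pair $(\phi,L)$ where $\phi$ is a cut-involution of $G$ and $L\subseteq V(G)$ is such that $G|_L$ is a union of connected components of $G-\mathrm{Fix}(\phi)$ and $(L,\mathrm{Fix}(\phi),\phi(L))$ is a partition of $V(G)$. Its left-folding map $\phi_L: V(G)\to V(G)$ is $\phi_L(v)=\phi(v)$ if $v\notin L$ and $\phi_L(v)=v$ if $v\in L$. For a set $S$ of folds of $G$, $G$ is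 left-cut-percolating under $S$ if there are $m\geq 0$ and sets $U_0,U_1,\ldots,U_m\subseteq V_1(G)$ with $|U_0|=1$, $U_m=V_1(G)$ and, for every $i\in\{1,\ldots,m\}$, a fold $(\phi_i,L_i)\in S$ with $U_i=(\phi_i)_{L_i}^{-1}(U_{i-1})$. Given probability spaces $\Omega=(X,\mu)$ and $\Lambda=(Y,\nu)$, a bigraphon over $\Omega$ and $\Lambda$ is a bounded measurable function $W:X\times Y\to\mathbb{R}_+=[0,\infty)$. A coloring of $G$ is a function $c:E(G)\to C$, and $(G,c)$ is then called a colored bigraph. For a sequence $W=(W_i)_{i\in C}$ of bigraphons all over the same spaces, $$t((G,c),W)=\int_{X^{V_1(G)}\times Y^{V_2(G)}}\prod_{(v,w)\in E(G)}W_{c(v,w)}(x_v,y_w)\,d(\mu\otimes\nu)(x,y).$$ A left-coloring of $G$ is a function $\ell:V_1(G)\to C'$; the coloring $\ell\otimes c:E(G)\to C'\times C$ is $(\ell\otimes c)(v,w)=(\ell(v),c(v,w))$. The colored bigraph $(G,c)$ is left-weakly Hölder if for every left-coloring $\ell:V_1(G)\to C'$ of $G$ and every sequence of bigraphons $W=(W_i)_{i\in C'\times C}$ all over the same spaces, $$t((G,\ell\otimes c),W)\leq\prod_{v\in V_1(G)}t((G,\ell(v)\otimes c),W)^{1/v_1(G)},$$ where $\ell(v)$ on the right-hand side denotes the constant left-coloring $V_1(G)\to C'$ equal to $\ell(v)$. *)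

theory Defs
  imports
    "HOL-Probability.Probability"
    "HOL-Algebra.Generated_Groups"
    "HOL-Combinatorics.Permutations"
begin

section \<open>Bigraphs\<close>

record 'a bigraph =
  V1 :: "'a set"
  V2 :: "'a set"
  edges :: "('a \<times> 'a) set"

definition bigraph :: "'a bigraph \<Rightarrow> bool" where
  "bigraph G \<longleftrightarrow>
     finite (V1 G) \<and> finite (V2 G) \<and> V1 G \<inter> V2 G = {} \<and> edges G \<subseteq> V1 G \<times> V2 G"

definition verts :: "'a bigraph \<Rightarrow> 'a set" where
  "verts G = V1 G \<union> V2 G"

definition induced :: "'a bigraph \<Rightarrow> 'a set \<Rightarrow> 'a bigraph" where
  "induced G U = \<lparr>V1 = V1 G \<inter> U, V2 = V2 G \<inter> U, edges = edges G \<inter> U \<times> U\<rparr>"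

definition del_verts :: "'a bigraph \<Rightarrow> 'a set \<Rightarrow> 'a bigraph" where
  "del_verts G U = induced G (verts G - U)"

definition reachable :: "'a bigraph \<Rightarrow> ('a \<times> 'a) set" where
  "reachable G = (edges G \<union> (edges G)\<inverse>)\<^sup>* \<inter> verts G \<times> verts G"

text \<open>The vertex sets of the connected components.\<close>

definition components :: "'a bigraph \<Rightarrow> 'a set set" where
  "components G = verts G // reachable G"

text \<open>The graph without vertices is not disconnected under this convention.\<close>

definition disconnected :: "'a bigraph \<Rightarrow> bool" where
  "disconnected G \<longleftrightarrow> (\<exists>u\<in>verts G. \<exists>v\<in>verts G. (u, v) \<notin> reachable G)"


section \<open>Automorphisms and folds\<close>

text \<open>
  A bijection of the vertex set is represented by its extension by the identity to the whole
  type, so that equality, composition and inverses of automorphisms are those of HOL functions.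
\<close>

definition automorphism :: "'a bigraph \<Rightarrow> ('a \<Rightarrow> 'a) \<Rightarrow> bool" where
  "automorphism G \<phi> \<longleftrightarrow>
     \<phi> permutes verts G \<and> \<phi> ` V1 G = V1 G \<and> \<phi> ` V2 G = V2 G \<and>
     (\<forall>v\<in>V1 G. \<forall>w\<in>V2 G. (\<phi> v, \<phi> w) \<in> edges G \<longleftrightarrow> (v, w) \<in> edges G)"

definition aut_group :: "'a bigraph \<Rightarrow> ('a \<Rightarrow> 'a) monoid" where
  "aut_group G = \<lparr>carrier = {\<phi>. automorphism G \<phi>}, mult = (\<circ>), one = id\<rparr>"

lemma automorphism_id: "automorphism G id"
  by (simp add: automorphism_def permutes_id)

lemma automorphism_comp:
  assumes "automorphism G \<phi>" "automorphism G \<psi>"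
  shows "automorphism G (\<phi> \<circ> \<psi>)"
proof -
  have "\<psi> v \<in> V1 G" if "v \<in> V1 G" for v
    using assms(2) that by (auto simp: automorphism_def)
  moreover have "\<psi> w \<in> V2 G" if "w \<in> V2 G" for w
    using assms(2) that by (auto simp: automorphism_def)
  ultimately show ?thesis
    using assms by (simp add: automorphism_def permutes_compose flip: image_image)
qed

lemma automorphism_inv:
  assumes "automorphism G \<phi>"
  shows "automorphism G (inv_into UNIV \<phi>)"
proof -
  have p: "\<phi> permutes verts G" and i: "\<phi> ` V1 G = V1 G" "\<phi> ` V2 G = V2 G"
    using assms by (auto simp: automorphism_def)
  have b: "inj \<phi>" "surj \<phi>"
    using p permutes_inj permutes_surj by blast+
  have j: "inv_into UNIV \<phi> ` V1 G = V1 G" "inv_into UNIV \<phi> ` V2 G = V2 G"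
    using i b by (metis image_inv_f_f)+
  have "(inv_into UNIV \<phi> v, inv_into UNIV \<phi> w) \<in> edges G \<longleftrightarrow> (v, w) \<in> edges G"
    if "v \<in> V1 G" "w \<in> V2 G" for v w
  proof -
    have "inv_into UNIV \<phi> v \<in> V1 G" "inv_into UNIV \<phi> w \<in> V2 G"
      using j that by blast+
    moreover have "\<phi> (inv_into UNIV \<phi> v) = v" "\<phi> (inv_into UNIV \<phi> w) = w"
      using b by (simp_all add: surj_f_inv_f)
    ultimately show ?thesis
      using assms unfolding automorphism_def by metis
  qed
  with j p show ?thesis
    by (auto simp: automorphism_def permutes_inv)
qed

lemma group_aut_group: "group (aut_group G)"
proof (rule groupI)
  fix \<phi> assume "\<phi> \<in> carrier (aut_group G)"
  then have a: "automorphism G \<phi>" by (simp add: aut_group_def)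
  then have "inv_into UNIV \<phi> \<circ> \<phi> = id"
    by (meson automorphism_def permutes_inv_o(2))
  with automorphism_inv [OF a]
  show "\<exists>\<psi>\<in>carrier (aut_group G). \<psi> \<otimes>\<^bsub>aut_group G\<^esub> \<phi> = \<one>\<^bsub>aut_group G\<^esub>"
    by (auto simp: aut_group_def)
qed (auto simp: aut_group_def automorphism_id automorphism_comp comp_assoc)

definition Fix :: "'a bigraph \<Rightarrow> ('a \<Rightarrow> 'a) \<Rightarrow> 'a set" where
  "Fix G \<phi> = {v \<in> verts G. \<phi> v = v}"

definition cut_involution :: "'a bigraph \<Rightarrow> ('a \<Rightarrow> 'a) \<Rightarrow> bool" where
  "cut_involution G \<phi> \<longleftrightarrow>
     automorphism G \<phi> \<and> \<phi> = inv_into UNIV \<phi> \<and> disconnected (del_verts G (Fix G \<phi>))"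

definition bigraph_fold :: "'a bigraph \<Rightarrow> ('a \<Rightarrow> 'a) \<times> 'a set \<Rightarrow> bool" where
  "bigraph_fold G = (\<lambda>(\<phi>, L).
     cut_involution G \<phi> \<and> L \<subseteq> verts G \<and>
     (\<exists>K \<subseteq> components (del_verts G (Fix G \<phi>)). L = \<Union>K) \<and>
     L \<union> Fix G \<phi> \<union> \<phi> ` L = verts G \<and>
     L \<inter> Fix G \<phi> = {} \<and> L \<inter> \<phi> ` L = {} \<and> Fix G \<phi> \<inter> \<phi> ` L = {})"

definition left_folding :: "('a \<Rightarrow> 'a) \<Rightarrow> 'a set \<Rightarrow> 'a \<Rightarrow> 'a" where
  "left_folding \<phi> L v = (if v \<in> L then v else \<phi> v)"

definition left_cut_percolating ::
    "'a bigraph \<Rightarrow> (('a \<Rightarrow> 'a) \<times> 'a set) set \<Rightarrow> bool" where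
  "left_cut_percolating G S \<longleftrightarrow>
     (\<exists>(m::nat) U.
        (\<forall>i\<in>{0..m}. U i \<subseteq> V1 G) \<and> card (U 0) = 1 \<and> U m = V1 G \<and>
        (\<forall>i\<in>{1..m}. \<exists>(\<phi>, L)\<in>S. U i = {v \<in> verts G. left_folding \<phi> L v \<in> U (i - 1)}))"


section \<open>Homomorphism densities and the left-weak Hoelder property\<close>

definition bigraphon :: "'x measure \<Rightarrow> 'y measure \<Rightarrow> ('x \<times> 'y \<Rightarrow> real) \<Rightarrow> bool" where
  "bigraphon M N W \<longleftrightarrow>
     W \<in> borel_measurable (M \<Otimes>\<^sub>M N) \<and>
     (\<forall>z\<in>space (M \<Otimes>\<^sub>M N). 0 \<le> W z) \<and>
     (\<exists>B. \<forall>z\<in>space (M \<Otimes>\<^sub>M N). W z \<le> B)"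

definition hom_density ::
    "'x measure \<Rightarrow> 'y measure \<Rightarrow> 'a bigraph \<Rightarrow> ('a \<times> 'a \<Rightarrow> 'c) \<Rightarrow>
     ('c \<Rightarrow> 'x \<times> 'y \<Rightarrow> real) \<Rightarrow> real" where
  "hom_density M N G c W =
     (\<integral>(x, y). (\<Prod>(v, w)\<in>edges G. W (c (v, w)) (x v, y w))
        \<partial>((\<Pi>\<^sub>M v\<in>V1 G. M) \<Otimes>\<^sub>M (\<Pi>\<^sub>M w\<in>V2 G. N)))"

definition left_tensor :: "('a \<Rightarrow> 'd) \<Rightarrow> ('a \<times> 'a \<Rightarrow> 'c) \<Rightarrow> 'a \<times> 'a \<Rightarrow> 'd \<times> 'c" where
  "left_tensor l c = (\<lambda>(v, w). (l v, c (v, w)))"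

text \<open>
  The color sets are types (colorings being relevant only on the edges, respectively on the
  left vertices). The underlying sets of the two probability spaces and the set of left colors
  are quantified over by way of the type parameters \<open>'x\<close>, \<open>'y\<close> and \<open>'d\<close>: the property as stated
  for all spaces and all left-colorings is the conjunction of all instances.
\<close>

definition left_weakly_Hoelder ::
    "'x itself \<Rightarrow> 'y itself \<Rightarrow> 'd itself \<Rightarrow> 'a bigraph \<Rightarrow> ('a \<times> 'a \<Rightarrow> 'c) \<Rightarrow> bool" where
  "left_weakly_Hoelder TX TY TD G c \<longleftrightarrow>
     (\<forall>(l :: 'a \<Rightarrow> 'd) (M :: 'x measure) (N :: 'y measure) (W :: 'd \<times> 'c \<Rightarrow> 'x \<times> 'y \<Rightarrow> real).
        prob_space M \<longrightarrow> prob_space N \<longrightarrow> (\<forall>i. bigraphon M N (W i)) \<longrightarrow>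
        hom_density M N G (left_tensor l c) W
          \<le> (\<Prod>v\<in>V1 G. hom_density M N G (left_tensor (\<lambda>_. l v) c) W powr (1 / real (card (V1 G)))))"

end

theory Submission
  imports Defs
begin

text \<open>
  For a fold \<open>(\<phi>, L)\<close> no edge joins \<open>L\<close> to \<open>\<phi>(L)\<close>, so, with the variables on the fixed vertices held
  constant, the integrand of the density factors into a part living on \<open>L\<close> and a part living on
  \<open>\<phi>(L)\<close>. The Cauchy--Schwarz inequality then bounds the squared density of a left-coloring \<open>l\<close> by
  the product of the densities of its two folded colorings \<open>l \<circ> \<phi>\<^sub>L\<close> and \<open>l \<circ> \<phi>\<^bsub>\<phi>(L)\<^esub>\<close>, which together
  use every color exactly twice as often as \<open>l\<close>. Hence, if \<open>l\<close> maximizes the quotient of the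
  two sides of the claim among the finitely many colorings with the same colors, so does
  \<open>l \<circ> \<phi>\<^sub>L\<close>. Following a percolating sequence of folds, one reaches a constant maximizer, whose
  quotient is at most 1.
\<close>

section \<open>Folds and the separation of their two sides\<close>

text \<open>A component is a reachability class, so an edge at one of its vertices merely prolongs a
  path from its representative.\<close>

lemma Union_components_closed:
  assumes K: "K \<subseteq> components H" and u: "u \<in> \<Union>K"
    and uw: "(u, w) \<in> edges H \<union> (edges H)\<inverse>" and w: "w \<in> verts H"
  shows "w \<in> \<Union>K"
proof -
  obtain x where x: "reachable H `` {x} \<in> K" "(x, u) \<in> reachable H"
    using K u by (fastforce simp: components_def quotient_def)
  then have "(x, w) \<in> reachable H"
    using uw w unfolding reachable_def by (auto intro: rtrancl_into_rtrancl)
  with x(1) show ?thesis by blast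
qed

text \<open>Collects what later arguments use of a fold. Only the last two facts, the absence of
  edges between \<open>L\<close> and its image, rest on \<open>L\<close> being a union of
  components.\<close>

lemma bigraph_foldD:
  assumes G: "bigraph G" and fold: "bigraph_fold G (\<phi>, L)"
  shows "\<phi> (\<phi> v) = v"
    and "v \<in> Fix G \<phi> \<Longrightarrow> \<phi> v = v"
    and "\<phi> ` V1 G = V1 G"
    and "(v, w) \<in> edges G \<Longrightarrow> (\<phi> v, \<phi> w) \<in> edges G"
    and "verts G = Fix G \<phi> \<union> (L \<union> \<phi> ` L)"
    and "Fix G \<phi> \<inter> L = {}" "Fix G \<phi> \<inter> \<phi> ` L = {}" "L \<inter> \<phi> ` L = {}"
    and "edges G \<inter> L \<times> \<phi> ` L = {}" "edges G \<inter> \<phi> ` L \<times> L = {}"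
proof -
  let ?F = "Fix G \<phi>"
  let ?H = "del_verts G ?F"
  have aut: "automorphism G \<phi>" and inv: "\<phi> = inv_into UNIV \<phi>"
    using fold by (auto simp: bigraph_fold_def cut_involution_def)
  have "inj \<phi>" using aut permutes_inj unfolding automorphism_def by blast
  with inv show "\<phi> (\<phi> v) = v" by (metis inv_f_f)
  show "v \<in> ?F \<Longrightarrow> \<phi> v = v" by (simp add: Fix_def)
  show "\<phi> ` V1 G = V1 G" using aut by (simp add: automorphism_def)
  show "(v, w) \<in> edges G \<Longrightarrow> (\<phi> v, \<phi> w) \<in> edges G"
    using aut G by (auto simp: automorphism_def bigraph_def)
  have part: "L \<union> ?F \<union> \<phi> ` L = verts G" "L \<inter> ?F = {}" "L \<inter> \<phi> ` L = {}" "?F \<inter> \<phi> ` L = {}"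
    using fold by (simp_all add: bigraph_fold_def)
  show V: "verts G = ?F \<union> (L \<union> \<phi> ` L)"
    and disj: "?F \<inter> L = {}" "?F \<inter> \<phi> ` L = {}" "L \<inter> \<phi> ` L = {}"
    using part by (blast, simp_all add: Int_commute)
  obtain K where K: "K \<subseteq> components ?H" "L = \<Union>K"
    using fold by (auto simp: bigraph_fold_def)
  have H: "verts ?H = verts G - ?F"
    "edges ?H = edges G \<inter> (verts G - ?F) \<times> (verts G - ?F)"
    by (auto simp: del_verts_def induced_def verts_def)
  \<comment> \<open>Neither endpoint of such an edge is fixed, so the edge survives the deletion of
    \<open>?F\<close> and forces both endpoints into the same side.\<close>
  have False if "u \<in> L" "w \<in> \<phi> ` L" "(u, w) \<in> edges G \<union> (edges G)\<inverse>" for u w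
  proof -
    have "u \<in> verts G - ?F" "w \<in> verts G - ?F" using that V disj by auto
    then have "(u, w) \<in> edges ?H \<union> (edges ?H)\<inverse>" "w \<in> verts ?H"
      using that(3) by (auto simp: H)
    then have "w \<in> L"
      using Union_components_closed[OF K(1)] that(1) K(2) by blast
    with that disj show False by blast
  qed
  then show "edges G \<inter> L \<times> \<phi> ` L = {}" "edges G \<inter> \<phi> ` L \<times> L = {}" by blast+
qed

section \<open>Analytic tools: Cauchy-Schwarz and marginals of product measures\<close>

text \<open>The integral of \<open>a\<close> times the square of \<open>f - t * g\<close> is a
  nonnegative quadratic polynomial in \<open>t\<close>. The weight \<open>a\<close> will be the
  contribution of the edges between fixed vertices; keeping it explicit avoids its square
  root.\<close>

lemma Cauchy_Schwarz_weighted_integral: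
  fixes a f g :: "'z \<Rightarrow> real"
  assumes nonneg: "\<And>z. z \<in> space P \<Longrightarrow> 0 \<le> a z"
    and ff: "integrable P (\<lambda>z. a z * (f z * f z))"
    and fg: "integrable P (\<lambda>z. a z * (f z * g z))"
    and gg: "integrable P (\<lambda>z. a z * (g z * g z))"
  shows "(\<integral>z. a z * (f z * g z) \<partial>P)\<^sup>2
    \<le> (\<integral>z. a z * (f z * f z) \<partial>P) * (\<integral>z. a z * (g z * g z) \<partial>P)"
proof -
  define A B C where "A = (\<integral>z. a z * (f z * f z) \<partial>P)" "B = (\<integral>z. a z * (f z * g z) \<partial>P)"
    "C = (\<integral>z. a z * (g z * g z) \<partial>P)"
  have quad: "0 \<le> A - 2 * t * B + t\<^sup>2 * C" for t
  proof -
    have "0 \<le> (\<integral>z. a z * (f z - t * g z)\<^sup>2 \<partial>P)"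
      by (intro Bochner_Integration.integral_nonneg) (simp add: nonneg)
    also have "\<dots> = (\<integral>z. a z * (f z * f z) - 2 * t * (a z * (f z * g z)) + t\<^sup>2 * (a z * (g z * g z)) \<partial>P)"
      by (intro arg_cong[where f = "integral\<^sup>L P"]) (auto simp: power2_eq_square algebra_simps)
    also have "\<dots> = A - 2 * t * B + t\<^sup>2 * C"
      using ff fg gg by (simp add: A_B_C_def)
    finally show ?thesis .
  qed
  have "0 \<le> C"
    unfolding A_B_C_def by (intro Bochner_Integration.integral_nonneg) (simp add: nonneg)
  have "B\<^sup>2 \<le> A * C"
  proof (cases "C = 0")
    case True
    have "B = 0"
    proof (rule ccontr)
      assume "B \<noteq> 0"
      \<comment> \<open>For \<open>C = 0\<close> the polynomial is the affine function
        \<open>A - 2 * t * B\<close>, which takes the value \<open>-1\<close> at this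
        \<open>t\<close>.\<close>
      with quad[of "(A + 1) / (2 * B)"] True show False by simp
    qed
    with True show ?thesis by simp
  next
    case False
    with \<open>0 \<le> C\<close> have "0 < C" by simp
    \<comment> \<open>The quadratic attains its minimum at \<open>t = B / C\<close>.\<close>
    have "A - 2 * (B / C) * B + (B / C)\<^sup>2 * C = A - B\<^sup>2 / C"
      using False by (simp add: power2_eq_square field_simps)
    with quad[of "B / C"] have "B\<^sup>2 / C \<le> A" by simp
    with \<open>0 < C\<close> show ?thesis by (simp add: field_simps)
  qed
  then show ?thesis by (simp add: A_B_C_def)
qed

text \<open>Forgetting one coordinate at each index yields the original product measure:
  \<open>merge\<close> splits the index set into independent blocks, and each block is projected
  pointwise to a marginal of \<open>M \<Otimes>\<^sub>M N\<close>.\<close>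

lemma distr_PiM_pair_marginals:
  assumes M: "prob_space M" and N: "prob_space N"
    and fin: "finite I" "finite J" and disj: "I \<inter> J = {}"
  shows "distr (\<Pi>\<^sub>M i\<in>I \<union> J. M \<Otimes>\<^sub>M N) ((\<Pi>\<^sub>M i\<in>I. M) \<Otimes>\<^sub>M (\<Pi>\<^sub>M j\<in>J. N))
      (\<lambda>\<omega>. (\<lambda>i\<in>I. fst (\<omega> i), \<lambda>j\<in>J. snd (\<omega> j)))
    = (\<Pi>\<^sub>M i\<in>I. M) \<Otimes>\<^sub>M (\<Pi>\<^sub>M j\<in>J. N)" (is "distr ?P ?Q ?h = _")
proof -
  interpret M: prob_space M by fact
  interpret N: prob_space N by fact
  interpret MN: pair_prob_space M N ..
  interpret K: product_prob_space "\<lambda>_. M \<Otimes>\<^sub>M N" ..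
  let ?KI = "\<Pi>\<^sub>M i\<in>I. M \<Otimes>\<^sub>M N" and ?KJ = "\<Pi>\<^sub>M i\<in>J. M \<Otimes>\<^sub>M N"
  have fst: "distr (M \<Otimes>\<^sub>M N) M fst = M"
    by (rule N.distr_pair_fst)
  have snd: "distr (M \<Otimes>\<^sub>M N) N snd = N"
  proof -
    have "distr (M \<Otimes>\<^sub>M N) N snd = distr (distr (N \<Otimes>\<^sub>M M) (M \<Otimes>\<^sub>M N) (\<lambda>(x, y). (y, x))) N snd"
      by (subst MN.distr_pair_swap) simp
    also have "\<dots> = distr (N \<Otimes>\<^sub>M M) N fst"
      by (subst distr_distr) (auto simp: comp_def intro!: distr_cong)
    finally show ?thesis by (simp add: M.distr_pair_fst)
  qed
  have I: "distr ?KI (\<Pi>\<^sub>M i\<in>I. M) (compose I fst) = (\<Pi>\<^sub>M i\<in>I. M)"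
    by (subst distr_PiM_finite_prob_space') (auto simp: fin fst MN.P.prob_space_axioms M)
  have J: "distr ?KJ (\<Pi>\<^sub>M i\<in>J. N) (compose J snd) = (\<Pi>\<^sub>M i\<in>J. N)"
    by (subst distr_PiM_finite_prob_space') (auto simp: fin snd MN.P.prob_space_axioms N)
  have [measurable]: "compose I fst \<in> measurable ?KI (\<Pi>\<^sub>M i\<in>I. M)"
    "compose J snd \<in> measurable ?KJ (\<Pi>\<^sub>M i\<in>J. N)"
    unfolding compose_def by measurable
  interpret NJ: prob_space "\<Pi>\<^sub>M i\<in>J. N" by (intro prob_space_PiM N)
  have "distr ?P ?Q ?h = distr (distr (?KI \<Otimes>\<^sub>M ?KJ) ?P (merge I J)) ?Q ?h"
    using K.distr_merge[OF disj fin] by simp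
  also have "\<dots> = distr (?KI \<Otimes>\<^sub>M ?KJ) ?Q (?h \<circ> merge I J)"
    by (rule distr_distr) measurable
  also have "\<dots> = distr (?KI \<Otimes>\<^sub>M ?KJ) ?Q (\<lambda>(x, y). (compose I fst x, compose J snd y))"
    using disj by (intro distr_cong) (auto simp: compose_def merge_def fun_eq_iff)
  also have "\<dots> = distr ?KI (\<Pi>\<^sub>M i\<in>I. M) (compose I fst) \<Otimes>\<^sub>M distr ?KJ (\<Pi>\<^sub>M i\<in>J. N) (compose J snd)"
    by (rule pair_measure_distr[symmetric]) (simp_all add: J NJ.sigma_finite_measure_axioms)
  finally show ?thesis by (simp add: I J)
qed

section \<open>Edge weights and densities over labellings of all vertices\<close>

text \<open>The edge set is a parameter so that the integrand of a density can be factored over the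
  parts into which a fold divides the edges.\<close>

definition edge_weight ::
    "('d \<times> 'c \<Rightarrow> 'x \<times> 'y \<Rightarrow> real) \<Rightarrow> ('a \<times> 'a \<Rightarrow> 'c) \<Rightarrow> ('a \<times> 'a) set \<Rightarrow>
     ('a \<Rightarrow> 'd) \<Rightarrow> ('a \<Rightarrow> 'x \<times> 'y) \<Rightarrow> real" where
  "edge_weight W c D l \<omega> = (\<Prod>(v, w)\<in>D. W (l v, c (v, w)) (fst (\<omega> v), snd (\<omega> w)))"

lemma edge_weight_cong:
  assumes "\<And>v w. (v, w) \<in> D \<Longrightarrow> l v = l' v \<and> \<omega> v = \<omega>' v \<and> \<omega> w = \<omega>' w"
  shows "edge_weight W c D l \<omega> = edge_weight W c D l' \<omega>'"
  unfolding edge_weight_def using assms by (intro prod.cong) (auto split: prod.splits)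

lemma edge_weight_Un:
  assumes "finite D" "finite D'" "D \<inter> D' = {}"
  shows "edge_weight W c (D \<union> D') l \<omega> = edge_weight W c D l \<omega> * edge_weight W c D' l \<omega>"
  unfolding edge_weight_def using assms by (rule prod.union_disjoint)

locale colored_bigraphons =
  fixes M :: "'x measure" and N :: "'y measure" and W :: "'d \<times> 'c \<Rightarrow> 'x \<times> 'y \<Rightarrow> real"
    and c :: "'a \<times> 'a \<Rightarrow> 'c"
  assumes prob_M: "prob_space M" and prob_N: "prob_space N"
    and bigraphon: "\<And>i. bigraphon M N (W i)"
begin

sublocale M: prob_space M by (rule prob_M)
sublocale N: prob_space N by (rule prob_N)
sublocale MN: pair_prob_space M N ..

text \<open>
  Every vertex carries a point of \<open>M \<Otimes>\<^sub>M N\<close>, of which only one coordinate matters. Thus the density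
  is an integral over a single product space indexed by all the vertices, and a fold can be treated
  without separating left and right vertices.
\<close>

abbreviation labellings :: "'a set \<Rightarrow> ('a \<Rightarrow> 'x \<times> 'y) measure" where
  "labellings I \<equiv> \<Pi>\<^sub>M i\<in>I. M \<Otimes>\<^sub>M N"

lemma W_measurable [measurable]: "W i \<in> borel_measurable (M \<Otimes>\<^sub>M N)"
  and W_nonneg: "z \<in> space (M \<Otimes>\<^sub>M N) \<Longrightarrow> 0 \<le> W i z"
  using bigraphon[of i] by (auto simp: bigraphon_def)

lemma prob_labellings: "prob_space (labellings I)"
  by (intro prob_space_PiM MN.P.prob_space_axioms)

lemma edge_weight_measurable:
  assumes "D \<subseteq> I \<times> I"
  shows "edge_weight W c D l \<in> borel_measurable (labellings I)"
  unfolding edge_weight_def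
proof (rule borel_measurable_prod)
  fix e assume "e \<in> D"
  then obtain v w where e: "e = (v, w)" and [measurable]: "v \<in> I" "w \<in> I"
    using assms by (cases e) auto
  show "(\<lambda>\<omega>. case e of (v, w) \<Rightarrow> W (l v, c (v, w)) (fst (\<omega> v), snd (\<omega> w)))
      \<in> borel_measurable (labellings I)"
    unfolding e by simp
qed

lemma labelled_edge_in_space:
  assumes "\<omega> \<in> space (labellings I)" "v \<in> I" "w \<in> I"
  shows "(fst (\<omega> v), snd (\<omega> w)) \<in> space (M \<Otimes>\<^sub>M N)"
  using assms by (auto simp: space_PiM space_pair_measure PiE_def Pi_def mem_Times_iff)

lemma edge_weight_nonneg:
  assumes "D \<subseteq> I \<times> I" "\<omega> \<in> space (labellings I)"
  shows "0 \<le> edge_weight W c D l \<omega>"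
  unfolding edge_weight_def using assms
  by (intro prod_nonneg) (auto intro!: W_nonneg labelled_edge_in_space)

lemma edge_weight_bounded:
  assumes "D \<subseteq> I \<times> I"
  obtains B where "0 \<le> B" "\<And>\<omega>. \<omega> \<in> space (labellings I) \<Longrightarrow> edge_weight W c D l \<omega> \<le> B"
proof -
  obtain B where B: "\<And>i z. z \<in> space (M \<Otimes>\<^sub>M N) \<Longrightarrow> W i z \<le> B i"
    using bigraphon unfolding bigraphon_def by metis
  let ?B = "\<Prod>(v, w)\<in>D. B (l v, c (v, w))"
  have "edge_weight W c D l \<omega> \<le> ?B" if "\<omega> \<in> space (labellings I)" for \<omega>
    unfolding edge_weight_def using assms that
    by (intro prod_mono) (auto intro!: W_nonneg B labelled_edge_in_space)
  \<comment> \<open>Taking the maximum with 0 makes the bound nonnegative without having to exhibit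
    a point of the space.\<close>
  then show ?thesis using that[of "max 0 ?B"] by (auto intro: max.coboundedI2)
qed

lemma edge_weight_merge_measurable:
  assumes "D \<subseteq> (I \<union> J) \<times> (I \<union> J)" and "p \<in> space (labellings I)"
  shows "(\<lambda>q. edge_weight W c D l (merge I J (p, q))) \<in> borel_measurable (labellings J)"
  using assms(2)
  by (intro measurable_compose[OF _ edge_weight_measurable[OF assms(1)]]) measurable

lemma integrable_edge_weight:
  assumes "D \<subseteq> I \<times> I"
  shows "integrable (labellings I) (edge_weight W c D l)"
proof -
  interpret prob_space "labellings I" by (rule prob_labellings)
  obtain B where "\<And>\<omega>. \<omega> \<in> space (labellings I) \<Longrightarrow> edge_weight W c D l \<omega> \<le> B"
    using edge_weight_bounded[OF assms] by blast
  then show ?thesis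
    by (intro integrable_const_bound[where B = B] AE_I2)
      (use assms in \<open>auto simp: edge_weight_nonneg edge_weight_measurable\<close>)
qed

definition density :: "'a bigraph \<Rightarrow> ('a \<Rightarrow> 'd) \<Rightarrow> real" where
  "density G l = (\<integral>\<omega>. edge_weight W c (edges G) l \<omega> \<partial>labellings (verts G))"

text \<open>The integrand reads only first coordinates on \<open>V1 G\<close> and second coordinates
  on \<open>V2 G\<close>, so the surplus coordinates can be integrated out by passing to
  marginals.\<close>

lemma hom_density_left_tensor:
  assumes "bigraph G"
  shows "hom_density M N G (left_tensor l c) W = density G l"
proof -
  have fin: "finite (V1 G)" "finite (V2 G)" and disj: "V1 G \<inter> V2 G = {}"
    and E: "edges G \<subseteq> V1 G \<times> V2 G"
    using assms by (auto simp: bigraph_def)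
  let ?Q = "(\<Pi>\<^sub>M v\<in>V1 G. M) \<Otimes>\<^sub>M (\<Pi>\<^sub>M w\<in>V2 G. N)"
  let ?f = "\<lambda>(x, y). \<Prod>(v, w)\<in>edges G. W (l v, c (v, w)) (x v, y w)"
  have [measurable]: "?f \<in> borel_measurable ?Q"
    unfolding case_prod_beta' prod.collapse
  proof (rule borel_measurable_prod)
    fix e assume "e \<in> edges G"
    with E have [measurable]: "fst e \<in> V1 G" "snd e \<in> V2 G" by auto
    show "(\<lambda>z. W (l (fst e), c e) (fst z (fst e), snd z (snd e))) \<in> borel_measurable ?Q"
      by measurable
  qed
  have "hom_density M N G (left_tensor l c) W = integral\<^sup>L ?Q ?f"
    by (simp add: hom_density_def left_tensor_def)
  also have "\<dots> = integral\<^sup>L (distr (labellings (V1 G \<union> V2 G)) ?Q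
      (\<lambda>\<omega>. (\<lambda>v\<in>V1 G. fst (\<omega> v), \<lambda>w\<in>V2 G. snd (\<omega> w)))) ?f"
    by (simp add: distr_PiM_pair_marginals[OF prob_M prob_N fin disj])
  also have "\<dots> = density G l"
    unfolding density_def verts_def edge_weight_def
    using E by (subst integral_distr)
      (auto intro!: Bochner_Integration.integral_cong prod.cong)
  finally show ?thesis .
qed


section \<open>Factoring the density along a fold\<close>

definition edges_at :: "('a \<times> 'a) set \<Rightarrow> 'a set \<Rightarrow> ('a \<times> 'a) set" where
  "edges_at E J = {(v, w) \<in> E. v \<in> J \<or> w \<in> J}"

text \<open>This is the conditional expectation of the weight of all edges meeting \<open>J\<close>,
  given the labels \<open>p\<close> on the fixed vertices.\<close>

definition side_integral ::
    "('a \<times> 'a) set \<Rightarrow> 'a set \<Rightarrow> 'a set \<Rightarrow> ('a \<Rightarrow> 'd) \<Rightarrow> ('a \<Rightarrow> 'x \<times> 'y) \<Rightarrow> real" where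
  "side_integral E F J l p =
     (\<integral>q. edge_weight W c (edges_at E J) l (merge F J (p, q)) \<partial>labellings J)"

lemma side_integral_measurable:
  assumes "edges_at E J \<subseteq> (F \<union> J) \<times> (F \<union> J)"
  shows "side_integral E F J l \<in> borel_measurable (labellings F)"
proof -
  interpret J: prob_space "labellings J" by (rule prob_labellings)
  note [measurable] = edge_weight_measurable[OF assms, of l]
  show ?thesis unfolding side_integral_def by measurable
qed

lemma side_integral_bounds:
  assumes "edges_at E J \<subseteq> (F \<union> J) \<times> (F \<union> J)"
  obtains B where "0 \<le> B"
    "\<And>p. p \<in> space (labellings F) \<Longrightarrow> 0 \<le> side_integral E F J l p \<and> side_integral E F J l p \<le> B"
proof -
  interpret J: prob_space "labellings J" by (rule prob_labellings)
  obtain B where B: "0 \<le> B"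
      "\<And>\<omega>. \<omega> \<in> space (labellings (F \<union> J)) \<Longrightarrow> edge_weight W c (edges_at E J) l \<omega> \<le> B"
    using edge_weight_bounded[OF assms] by blast
  have "0 \<le> side_integral E F J l p \<and> side_integral E F J l p \<le> B"
    if p: "p \<in> space (labellings F)" for p
  proof -
    let ?f = "\<lambda>q. edge_weight W c (edges_at E J) l (merge F J (p, q))"
    have sp: "merge F J (p, q) \<in> space (labellings (F \<union> J))" if "q \<in> space (labellings J)" for q
      using measurable_space[OF measurable_merge, of "(p, q)"] p that by (simp add: space_pair_measure)
    note [measurable] = edge_weight_merge_measurable[OF assms p]
    have 0: "0 \<le> ?f q" "?f q \<le> B" if "q \<in> space (labellings J)" for q
      using sp[OF that] by (auto intro: edge_weight_nonneg[OF assms] B)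
    have "integrable (labellings J) ?f"
      by (intro J.integrable_const_bound[where B = B] AE_I2) (auto simp: 0)
    then have "(\<integral>q. ?f q \<partial>labellings J) \<le> B"
      using 0 by (intro J.integral_le_const AE_I2) auto
    with 0 show ?thesis
      unfolding side_integral_def by (auto intro: Bochner_Integration.integral_nonneg)
  qed
  with B(1) show ?thesis by (rule that)
qed

text \<open>Without edges between \<open>L\<close> and \<open>R\<close>, every edge lies inside
  \<open>F\<close> or meets exactly one of the two sides. Once the labels on \<open>F\<close> are
  fixed, the two side weights depend on separate variables, and Fubini turns the integral of their
  product into a product of integrals.\<close>

lemma integral_edge_weight_split:
  assumes fin: "finite F" "finite L" "finite R"
    and disj: "F \<inter> L = {}" "F \<inter> R = {}" "L \<inter> R = {}"
    and E: "E \<subseteq> (F \<union> (L \<union> R)) \<times> (F \<union> (L \<union> R))"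
    and cross: "E \<inter> L \<times> R = {}" "E \<inter> R \<times> L = {}"
  shows "(\<integral>\<omega>. edge_weight W c E l \<omega> \<partial>labellings (F \<union> (L \<union> R))) =
    (\<integral>p. edge_weight W c (E \<inter> F \<times> F) l p * (side_integral E F L l p * side_integral E F R l p)
      \<partial>labellings F)"
proof -
  interpret K: product_prob_space "\<lambda>_ :: 'a. M \<Otimes>\<^sub>M N" ..
  have finE: "finite E" using E fin by (meson finite_SigmaI finite_UnI finite_subset)
  have split: "E = (E \<inter> F \<times> F) \<union> (edges_at E L \<union> edges_at E R)"
    using E by (auto simp: edges_at_def)
  have fin_parts: "finite (E \<inter> F \<times> F)" "finite (edges_at E L)" "finite (edges_at E R)"
    using finE by (auto simp: edges_at_def intro: finite_subset)
  have "edges_at E L \<inter> edges_at E R = {}" "(E \<inter> F \<times> F) \<inter> (edges_at E L \<union> edges_at E R) = {}"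
    using disj cross by (auto simp: edges_at_def)
  then have weight_split: "edge_weight W c E l \<omega> = edge_weight W c (E \<inter> F \<times> F) l \<omega> *
      (edge_weight W c (edges_at E L) l \<omega> * edge_weight W c (edges_at E R) l \<omega>)" for \<omega>
    using fin_parts by (subst split) (simp only: edge_weight_Un finite_UnI)
  have weight: "edge_weight W c E l (merge F (L \<union> R) (p, merge L R (q, r))) =
      edge_weight W c (E \<inter> F \<times> F) l p *
      (edge_weight W c (edges_at E L) l (merge F L (p, q)) *
       edge_weight W c (edges_at E R) l (merge F R (p, r)))" (is "?lhs = _") for p q r
  proof -
    let ?\<omega> = "merge F (L \<union> R) (p, merge L R (q, r))"
    have "?lhs = edge_weight W c (E \<inter> F \<times> F) l ?\<omega> *
        (edge_weight W c (edges_at E L) l ?\<omega> * edge_weight W c (edges_at E R) l ?\<omega>)"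
      by (rule weight_split)
    also have "edge_weight W c (E \<inter> F \<times> F) l ?\<omega> = edge_weight W c (E \<inter> F \<times> F) l p"
      by (rule edge_weight_cong) (auto simp: merge_def)
    also have "edge_weight W c (edges_at E L) l ?\<omega>
        = edge_weight W c (edges_at E L) l (merge F L (p, q))"
      by (rule edge_weight_cong) (use E cross disj in \<open>force simp: merge_def edges_at_def\<close>)
    also have "edge_weight W c (edges_at E R) l ?\<omega>
        = edge_weight W c (edges_at E R) l (merge F R (p, r))"
      by (rule edge_weight_cong) (use E cross disj in \<open>force simp: merge_def edges_at_def\<close>)
    finally show ?thesis .
  qed
  have "(\<integral>\<omega>. edge_weight W c E l \<omega> \<partial>labellings (F \<union> (L \<union> R)))
      = (\<integral>p. \<integral>s. edge_weight W c E l (merge F (L \<union> R) (p, s)) \<partial>labellings (L \<union> R) \<partial>labellings F)"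
    using fin disj by (intro K.product_integral_fold integrable_edge_weight[OF E]) auto
  also have "\<dots> = (\<integral>p. edge_weight W c (E \<inter> F \<times> F) l p *
      (side_integral E F L l p * side_integral E F R l p) \<partial>labellings F)"
  proof (rule Bochner_Integration.integral_cong[OF refl])
    fix p assume p: "p \<in> space (labellings F)"
    interpret LR: prob_space "labellings (L \<union> R)" by (rule prob_labellings)
    obtain B where B: "\<And>\<omega>. \<omega> \<in> space (labellings (F \<union> (L \<union> R))) \<Longrightarrow> edge_weight W c E l \<omega> \<le> B"
      using edge_weight_bounded[OF E] by blast
    have sp: "merge F (L \<union> R) (p, s) \<in> space (labellings (F \<union> (L \<union> R)))"
      if "s \<in> space (labellings (L \<union> R))" for s
      using measurable_space[OF measurable_merge, of "(p, s)"] p that by (simp add: space_pair_measure)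
    \<comment> \<open>The inner identity is needed for every \<open>p\<close>, not merely almost
      every \<open>p\<close>, so integrability of the slice is taken from boundedness.\<close>
    have "integrable (labellings (L \<union> R)) (\<lambda>s. edge_weight W c E l (merge F (L \<union> R) (p, s)))"
      using edge_weight_merge_measurable[OF E p] sp
      by (intro LR.integrable_const_bound[where B = B] AE_I2) (auto simp: B edge_weight_nonneg[OF E])
    then have "(\<integral>s. edge_weight W c E l (merge F (L \<union> R) (p, s)) \<partial>labellings (L \<union> R))
        = (\<integral>q. \<integral>r. edge_weight W c E l (merge F (L \<union> R) (p, merge L R (q, r)))
            \<partial>labellings R \<partial>labellings L)"
      using fin disj by (intro K.product_integral_fold) auto
    also have "\<dots> = edge_weight W c (E \<inter> F \<times> F) l p *
        (side_integral E F L l p * side_integral E F R l p)"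
      unfolding weight side_integral_def by simp
    finally show "(\<integral>s. edge_weight W c E l (merge F (L \<union> R) (p, s)) \<partial>labellings (L \<union> R)) = \<dots>" .
  qed
  finally show ?thesis .
qed

text \<open>Change of variables along \<phi>. Permuting coordinates preserves the product measure,
  the labels \<open>p\<close> stay put because \<phi> fixes \<open>F\<close> pointwise, edges and
  their colors are invariant, and \<open>l \<circ> \<phi>\<close> carries the left colors
  across.\<close>

lemma side_integral_image:
  assumes disj: "F \<inter> J = {}" "F \<inter> \<phi> ` J = {}"
    and E: "edges_at E J \<subseteq> (F \<union> J) \<times> (F \<union> J)"
    and p: "p \<in> space (labellings F)"
    and invol: "\<And>v. \<phi> (\<phi> v) = v" and fixed: "\<And>v. v \<in> F \<Longrightarrow> \<phi> v = v"
    and aut: "\<And>v w. (v, w) \<in> E \<Longrightarrow> (\<phi> v, \<phi> w) \<in> E"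
    and c: "\<And>v w. (v, w) \<in> E \<Longrightarrow> c (\<phi> v, \<phi> w) = c (v, w)"
  shows "side_integral E F (\<phi> ` J) (l \<circ> \<phi>) p = side_integral E F J l p"
proof -
  have inj: "inj \<phi>" using invol by (metis injI)
  have bij: "bij_betw (map_prod \<phi> \<phi>) (edges_at E J) (edges_at E (\<phi> ` J))"
    by (rule bij_betw_byWitness[where f' = "map_prod \<phi> \<phi>"])
      (auto simp: edges_at_def invol intro: aut)
  have weight: "edge_weight W c (edges_at E (\<phi> ` J)) (l \<circ> \<phi>) (merge F (\<phi> ` J) (p, r))
      = edge_weight W c (edges_at E J) l (merge F J (p, \<lambda>v\<in>J. r (\<phi> v)))" for r
  proof -
    have shift: "merge F (\<phi> ` J) (p, r) (\<phi> v) = merge F J (p, \<lambda>v\<in>J. r (\<phi> v)) v" if "v \<in> F \<union> J" for v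
      using that disj fixed by (auto simp: merge_def)
    show ?thesis
      unfolding edge_weight_def
      by (subst prod.reindex_bij_betw[OF bij, symmetric], rule prod.cong)
        (use E in \<open>auto simp: invol shift edges_at_def c\<close>)
  qed
  have "side_integral E F (\<phi> ` J) (l \<circ> \<phi>) p
      = (\<integral>r. edge_weight W c (edges_at E J) l (merge F J (p, \<lambda>v\<in>J. r (\<phi> v))) \<partial>labellings (\<phi> ` J))"
    unfolding side_integral_def weight ..
  also have "\<dots> = (\<integral>q. edge_weight W c (edges_at E J) l (merge F J (p, q))
      \<partial>distr (labellings (\<phi> ` J)) (labellings J) (\<lambda>r. \<lambda>v\<in>J. r (\<phi> v)))"
    by (rule integral_distr[symmetric, OF _ edge_weight_merge_measurable[OF E p]]) measurable
  also have "distr (labellings (\<phi> ` J)) (labellings J) (\<lambda>r. \<lambda>v\<in>J. r (\<phi> v)) = labellings J"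
    using inj by (intro distr_PiM_reindex MN.P.prob_space_axioms) (auto intro: inj_on_subset)
  finally show ?thesis unfolding side_integral_def .
qed

lemma side_integral_cong:
  assumes "\<And>v w. (v, w) \<in> edges_at E J \<Longrightarrow> l v = l' v"
  shows "side_integral E F J l = side_integral E F J l'"
  unfolding side_integral_def using assms
  by (intro ext Bochner_Integration.integral_cong edge_weight_cong) auto

lemma density_nonneg: "bigraph G \<Longrightarrow> 0 \<le> density G l"
  unfolding density_def
  by (intro Bochner_Integration.integral_nonneg edge_weight_nonneg)
    (auto simp: bigraph_def verts_def)

lemma density_cong:
  assumes "bigraph G" "\<And>v. v \<in> V1 G \<Longrightarrow> l v = l' v"
  shows "density G l = density G l'"
  unfolding density_def using assms
  by (intro Bochner_Integration.integral_cong edge_weight_cong) (auto simp: bigraph_def)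

section \<open>The Cauchy-Schwarz inequality for a fold\<close>

text \<open>Let \<open>f\<close> and \<open>g\<close> be the side integrals of \<open>l\<close> over
  \<open>L\<close> and over its image. The density of \<open>l\<close> integrates
  \<open>f * g\<close> against the weight \<open>a\<close>. Folding overwrites one side by a mirror
  copy of the other, so the folded densities integrate \<open>f * f\<close> and \<open>g * g\<close>
  against the same weight.\<close>

lemma density_fold:
  assumes G: "bigraph G" and fold: "bigraph_fold G (\<phi>, L)"
    and c: "\<And>v w. (v, w) \<in> edges G \<Longrightarrow> c (\<phi> v, \<phi> w) = c (v, w)"
  shows "(density G l)\<^sup>2
    \<le> density G (l \<circ> left_folding \<phi> L) * density G (l \<circ> left_folding \<phi> (\<phi> ` L))"
proof -
  note fD = bigraph_foldD[OF G fold]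
  define F R E where "F = Fix G \<phi>" "R = \<phi> ` L" "E = edges G"
  note FRE = F_R_E_def
  have V: "verts G = F \<union> (L \<union> R)" and disj: "F \<inter> L = {}" "F \<inter> R = {}" "L \<inter> R = {}"
    and cross: "E \<inter> L \<times> R = {}" "E \<inter> R \<times> L = {}"
    and fixed: "\<And>v. v \<in> F \<Longrightarrow> \<phi> v = v"
    using fD by (auto simp: FRE)
  have RL: "\<phi> ` R = L" unfolding FRE(2) image_image by (simp add: fD(1))
  have "finite (verts G)" and EV: "E \<subseteq> verts G \<times> verts G"
    using G by (auto simp: bigraph_def verts_def FRE)
  then have fin: "finite F" "finite L" "finite R" and E: "E \<subseteq> (F \<union> (L \<union> R)) \<times> (F \<union> (L \<union> R))"
    by (auto simp: V)
  have EL: "edges_at E L \<subseteq> (F \<union> L) \<times> (F \<union> L)" and ER: "edges_at E R \<subseteq> (F \<union> R) \<times> (F \<union> R)"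
    using E cross by (auto simp: edges_at_def)
  define a f g where "a = edge_weight W c (E \<inter> F \<times> F) l"
    "f = side_integral E F L l" "g = side_integral E F R l"
  note afg = a_f_g_def
  have split: "density G l' = (\<integral>p. edge_weight W c (E \<inter> F \<times> F) l' p *
      (side_integral E F L l' p * side_integral E F R l' p) \<partial>labellings F)" for l'
    using integral_edge_weight_split[OF fin disj E cross, of l'] by (simp add: density_def V FRE(3))
  have imL: "side_integral E F R (l \<circ> \<phi>) p = f p" if "p \<in> space (labellings F)" for p
    unfolding afg FRE(2)
    by (rule side_integral_image) (use disj EL that fixed fD c in \<open>auto simp: FRE\<close>)
  \<comment> \<open>The same reflection with the sides exchanged, reading \<open>L\<close> as the
    image of \<open>R\<close>.\<close>
  have imR: "side_integral E F L (l \<circ> \<phi>) p = g p" if "p \<in> space (labellings F)" for p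
    unfolding afg RL[symmetric]
    by (rule side_integral_image) (use disj ER that fixed fD c RL in \<open>auto simp: FRE\<close>)
  have foldL: "density G (l \<circ> left_folding \<phi> L) = (\<integral>p. a p * (f p * f p) \<partial>labellings F)"
  proof -
    \<comment> \<open>Folding does not move the vertices of \<open>F\<close>, so edges inside
      \<open>F\<close> contribute the same weight before and after.\<close>
    have "edge_weight W c (E \<inter> F \<times> F) (l \<circ> left_folding \<phi> L) p = a p" for p
      unfolding afg by (rule edge_weight_cong) (auto simp: left_folding_def fixed)
    moreover have "side_integral E F L (l \<circ> left_folding \<phi> L) = f"
      unfolding afg by (rule side_integral_cong) (use EL fixed in \<open>auto simp: left_folding_def\<close>)
    moreover have "side_integral E F R (l \<circ> left_folding \<phi> L) = side_integral E F R (l \<circ> \<phi>)"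
      by (rule side_integral_cong) (use ER disj fixed in \<open>auto simp: left_folding_def\<close>)
    ultimately show ?thesis
      by (auto simp: split imL intro!: Bochner_Integration.integral_cong)
  qed
  have foldR: "density G (l \<circ> left_folding \<phi> R) = (\<integral>p. a p * (g p * g p) \<partial>labellings F)"
  proof -
    have "edge_weight W c (E \<inter> F \<times> F) (l \<circ> left_folding \<phi> R) p = a p" for p
      unfolding afg by (rule edge_weight_cong) (auto simp: left_folding_def fixed)
    moreover have "side_integral E F R (l \<circ> left_folding \<phi> R) = g"
      unfolding afg by (rule side_integral_cong) (use ER fixed in \<open>auto simp: left_folding_def\<close>)
    moreover have "side_integral E F L (l \<circ> left_folding \<phi> R) = side_integral E F L (l \<circ> \<phi>)"
      by (rule side_integral_cong) (use EL disj fixed in \<open>auto simp: left_folding_def\<close>)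
    ultimately show ?thesis
      by (auto simp: split imR intro!: Bochner_Integration.integral_cong)
  qed
  interpret F: prob_space "labellings F" by (rule prob_labellings)
  have aF: "E \<inter> F \<times> F \<subseteq> F \<times> F" by blast
  obtain Ba where Ba: "0 \<le> Ba" "\<And>p. p \<in> space (labellings F) \<Longrightarrow> a p \<le> Ba"
    unfolding afg using edge_weight_bounded[OF aF] by blast
  have a_nonneg: "0 \<le> a p" if "p \<in> space (labellings F)" for p
    unfolding afg by (rule edge_weight_nonneg[OF aF that])
  obtain Bf where Bf: "0 \<le> Bf" "\<And>p. p \<in> space (labellings F) \<Longrightarrow> 0 \<le> f p \<and> f p \<le> Bf"
    unfolding afg using side_integral_bounds[OF EL] by blast
  obtain Bg where Bg: "0 \<le> Bg" "\<And>p. p \<in> space (labellings F) \<Longrightarrow> 0 \<le> g p \<and> g p \<le> Bg"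
    unfolding afg using side_integral_bounds[OF ER] by blast
  have [measurable]: "a \<in> borel_measurable (labellings F)" "f \<in> borel_measurable (labellings F)"
    "g \<in> borel_measurable (labellings F)"
    unfolding afg
    by (rule edge_weight_measurable[OF aF] side_integral_measurable[OF EL]
        side_integral_measurable[OF ER])+
  \<comment> \<open>Stated for general bounded \<open>h\<close> and \<open>k\<close> so as to cover
    all three integrability conditions of Cauchy-Schwarz.\<close>
  have int: "integrable (labellings F) (\<lambda>p. a p * (h p * k p))"
    if [measurable]: "h \<in> borel_measurable (labellings F)" "k \<in> borel_measurable (labellings F)"
      and "0 \<le> Bh" "0 \<le> Bk"
      and "\<And>p. p \<in> space (labellings F) \<Longrightarrow> 0 \<le> h p \<and> h p \<le> Bh"
      and "\<And>p. p \<in> space (labellings F) \<Longrightarrow> 0 \<le> k p \<and> k p \<le> Bk" for h k Bh Bk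
    by (rule F.integrable_const_bound[where B = "Ba * (Bh * Bk)"], rule AE_I2)
      (use that Ba a_nonneg in \<open>auto simp: abs_mult intro!: mult_mono\<close>)
  have "density G l = (\<integral>p. a p * (f p * g p) \<partial>labellings F)"
    unfolding split afg ..
  moreover have "(\<integral>p. a p * (f p * g p) \<partial>labellings F)\<^sup>2
      \<le> (\<integral>p. a p * (f p * f p) \<partial>labellings F) * (\<integral>p. a p * (g p * g p) \<partial>labellings F)"
    by (intro Cauchy_Schwarz_weighted_integral a_nonneg int[OF _ _ Bf(1) Bf(1)]
        int[OF _ _ Bf(1) Bg(1)] int[OF _ _ Bg(1) Bg(1)] Bf Bg) measurable
  ultimately show ?thesis
    using foldL foldR by (simp add: FRE(2))
qed

section \<open>Percolation and the maximal quotient\<close>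

lemma left_folding_V1:
  assumes "bigraph G" "bigraph_fold G (\<phi>, L)" "v \<in> V1 G"
  shows "left_folding \<phi> K v \<in> V1 G"
  using bigraph_foldD(3)[OF assms(1,2)] assms(3) by (auto simp: left_folding_def)

text \<open>At each vertex \<open>v\<close> the two foldings together produce \<open>v\<close> and
  \<open>\<phi> v\<close> once each, and \<phi> permutes \<open>V1 G\<close>. This balances the
  denominators of the quotients when a coloring is replaced by its two folded versions.\<close>

lemma prod_left_folding:
  fixes b :: "'a \<Rightarrow> real"
  assumes G: "bigraph G" and fold: "bigraph_fold G (\<phi>, L)"
  shows "(\<Prod>v\<in>V1 G. b (left_folding \<phi> L v)) * (\<Prod>v\<in>V1 G. b (left_folding \<phi> (\<phi> ` L) v))
    = (\<Prod>v\<in>V1 G. b v)\<^sup>2"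
proof -
  note fD = bigraph_foldD[OF G fold]
  have "b (left_folding \<phi> L v) * b (left_folding \<phi> (\<phi> ` L) v) = b v * b (\<phi> v)" if "v \<in> V1 G" for v
  proof -
    have "v \<in> Fix G \<phi> \<union> (L \<union> \<phi> ` L)" using that fD(5) by (auto simp: verts_def)
    then show ?thesis using fD by (auto simp: left_folding_def)
  qed
  then have "(\<Prod>v\<in>V1 G. b (left_folding \<phi> L v)) * (\<Prod>v\<in>V1 G. b (left_folding \<phi> (\<phi> ` L) v))
      = (\<Prod>v\<in>V1 G. b v) * (\<Prod>v\<in>V1 G. b (\<phi> v))"
    by (simp flip: prod.distrib)
  also have "(\<Prod>v\<in>V1 G. b (\<phi> v)) = (\<Prod>v\<in>V1 G. b v)"
  proof (rule prod.reindex_bij_betw)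
    have "inj \<phi>" using fD(1) by (metis injI)
    then show "bij_betw \<phi> (V1 G) (V1 G)"
      using fD(3) by (auto simp: bij_betw_def intro: inj_on_subset)
  qed
  finally show ?thesis by (simp add: power2_eq_square)
qed

text \<open>
  Positive upper bounds \<open>b d\<close> replace the roots of the constant densities, so that the quotient
  maximized in the proof is defined also when some of these densities vanish.
\<close>

lemma density_le_prod:
  assumes G: "bigraph G" and S: "\<forall>f\<in>S. bigraph_fold G f" and perc: "left_cut_percolating G S"
    and c: "\<And>\<phi> L v w. (\<phi>, L) \<in> S \<Longrightarrow> (v, w) \<in> edges G \<Longrightarrow> c (\<phi> v, \<phi> w) = c (v, w)"
    and b_pos: "\<And>d. 0 < b d"
    and b: "\<And>d. density G (\<lambda>_. d) \<le> b d ^ card (V1 G)"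
  shows "density G l \<le> (\<Prod>v\<in>V1 G. b (l v))"
proof -
  define q where "q k = density G k / (\<Prod>v\<in>V1 G. b (k v))" for k
  define X where "X = {k. k ` V1 G \<subseteq> l ` V1 G}"
  have finV: "finite (V1 G)" using G by (simp add: bigraph_def)
  have den: "0 < (\<Prod>v\<in>V1 G. b (k v))" for k :: "'a \<Rightarrow> 'd"
    by (intro prod_pos) (simp add: b_pos)
  have q_cong: "q k = q k'" if "\<And>v. v \<in> V1 G \<Longrightarrow> k v = k' v" for k k'
    using that density_cong[OF G, of k k'] by (simp add: q_def)
  have q_nonneg: "0 \<le> q k" for k
    unfolding q_def using den[of k] density_nonneg[OF G] by (simp add: less_imp_le)
  \<comment> \<open>Colorings in \<open>X\<close> are unrestricted outside \<open>V1 G\<close>, so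
    \<open>X\<close> itself may be infinite. Since \<open>q\<close> sees only the values on
    \<open>V1 G\<close>, its image is still finite and a maximum exists.\<close>
  have "q ` X \<subseteq> q ` (V1 G \<rightarrow>\<^sub>E l ` V1 G)"
  proof
    fix y assume "y \<in> q ` X"
    then obtain k where k: "k \<in> X" "y = q k" by blast
    then have "y = q (restrict k (V1 G))" "restrict k (V1 G) \<in> V1 G \<rightarrow>\<^sub>E l ` V1 G"
      by (auto simp: X_def intro: q_cong)
    then show "y \<in> q ` (V1 G \<rightarrow>\<^sub>E l ` V1 G)" by blast
  qed
  then have finX: "finite (q ` X)"
    by (rule finite_subset) (simp add: finite_PiE finV)
  define m where "m = Max (q ` X)"
  have lX: "l \<in> X" by (simp add: X_def)
  have max: "q k \<le> m" if "k \<in> X" for k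
    unfolding m_def using finX that by simp
  obtain k0 where k0: "k0 \<in> X" "q k0 = m"
    using Max_in[OF finX] lX unfolding m_def by fastforce
  obtain n :: nat and U where U: "card (U 0) = 1" "U n = V1 G"
    and step: "\<forall>i\<in>{1..n}. \<exists>(\<phi>, L)\<in>S. U i = {v \<in> verts G. left_folding \<phi> L v \<in> U (i - 1)}"
    using perc unfolding left_cut_percolating_def by blast
  obtain v0 where v0: "U 0 = {v0}" using U(1) by (auto simp: card_1_singleton_iff)
  define d where "d = k0 v0"
  have "m \<le> 1"
  \<comment> \<open>In the remaining case \<open>m\<close> is positive and can be cancelled
    below.\<close>
  proof (cases "m \<le> 0")
    case False
    \<comment> \<open>Invariant along the percolating sequence: some maximizer is constantly
      \<open>d\<close> on \<open>U i\<close>. As \<open>U (Suc i)\<close> is the preimage of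
      \<open>U i\<close> under a folding map, composing with that map extends the constancy to
      \<open>U (Suc i)\<close>.\<close>
    have "\<exists>k\<in>X. q k = m \<and> (\<forall>v\<in>U i. k v = d)" if "i \<le> n" for i
      using that
    proof (induction i)
      case 0
      show ?case using k0 v0 by (auto simp: d_def)
    next
      case (Suc i)
      then obtain k where k: "k \<in> X" "q k = m" "\<forall>v\<in>U i. k v = d" by auto
      obtain \<phi> L where fS: "(\<phi>, L) \<in> S" and US: "U (Suc i) = {v \<in> verts G. left_folding \<phi> L v \<in> U i}"
        using step[rule_format, of "Suc i"] Suc.prems by auto
      have fold: "bigraph_fold G (\<phi>, L)" using S fS by blast
      let ?k1 = "k \<circ> left_folding \<phi> L" and ?k2 = "k \<circ> left_folding \<phi> (\<phi> ` L)"
      have kX: "?k1 \<in> X" "?k2 \<in> X"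
        using k(1) left_folding_V1[OF G fold] by (auto simp: X_def)
      \<comment> \<open>The fold inequality gives \<open>m * m \<le> q ?k1 * q ?k2\<close>; bounding
        the second factor by \<open>m\<close> leaves \<open>m \<le> q ?k1\<close>, so
        \<open>?k1\<close> is again a maximizer.\<close>
      have "m * m = (density G k)\<^sup>2 / (\<Prod>v\<in>V1 G. b (k v))\<^sup>2"
        by (simp add: q_def power2_eq_square flip: k(2))
      also have "\<dots> \<le> density G ?k1 * density G ?k2 / (\<Prod>v\<in>V1 G. b (k v))\<^sup>2"
        by (intro divide_right_mono density_fold[OF G fold]) (use c fS in auto)
      also have "\<dots> = q ?k1 * q ?k2"
        using prod_left_folding[OF G fold, of "\<lambda>v. b (k v)"] by (simp add: q_def)
      also have "\<dots> \<le> q ?k1 * m"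
        by (intro mult_left_mono max kX q_nonneg)
      finally have "m \<le> q ?k1" using False by simp
      with max[OF kX(1)] have "q ?k1 = m" by simp
      moreover have "\<forall>v\<in>U (Suc i). ?k1 v = d" using k(3) by (auto simp: US)
      ultimately show ?case using kX(1) by blast
    qed
    from this[of n] obtain k where k: "q k = m" "\<forall>v\<in>V1 G. k v = d" using U(2) by auto
    have "m = density G (\<lambda>_. d) / b d ^ card (V1 G)"
      using k q_cong[of k "\<lambda>_. d"] by (simp add: q_def)
    also have "\<dots> \<le> 1" using b[of d] b_pos[of d] by (simp add: divide_le_eq)
    finally show ?thesis .
  qed simp
  with max[OF lX] have "q l \<le> 1" by simp
  with den[of l] show ?thesis by (simp add: q_def divide_le_eq)
qed

end

section \<open>The left-weak Hoelder inequality\<close>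

theorem theorem3p3:
  fixes G :: "'a bigraph"
    and S :: "(('a \<Rightarrow> 'a) \<times> 'a set) set"
    and c :: "'a \<times> 'a \<Rightarrow> 'c"
  assumes "bigraph G"
    and "\<forall>f\<in>S. bigraph_fold G f"
    and "left_cut_percolating G S"
    and "\<forall>\<sigma>\<in>generate (aut_group G) (fst ` S). \<forall>(v, w)\<in>edges G. c (\<sigma> v, \<sigma> w) = c (v, w)"
  shows "left_weakly_Hoelder TYPE('x) TYPE('y) TYPE('d) G c"
  unfolding left_weakly_Hoelder_def
proof (intro allI impI)
  fix l :: "'a \<Rightarrow> 'd" and M :: "'x measure" and N :: "'y measure"
    and W :: "'d \<times> 'c \<Rightarrow> 'x \<times> 'y \<Rightarrow> real"
  assume "prob_space M" "prob_space N" "\<forall>i. bigraphon M N (W i)"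
  then interpret colored_bigraphons M N W c
    by (simp add: colored_bigraphons_def)
  let ?n = "card (V1 G)"
  have inv: "c (\<phi> v, \<phi> w) = c (v, w)" if "(\<phi>, L) \<in> S" "(v, w) \<in> edges G" for \<phi> L v w
  proof -
    have "\<phi> \<in> generate (aut_group G) (fst ` S)"
      using that(1) by (force intro: generate.incl)
    with assms(4) that(2) show ?thesis by blast
  qed
  \<comment> \<open>The starting set of the percolation is a singleton inside \<open>V1 G\<close>.
    Hence \<open>1 / ?n\<close> is a genuine positive exponent and not the default value
    \<open>1 / 0 = 0\<close>.\<close>
  have n: "0 < ?n"
  proof -
    obtain n U where U: "\<forall>i\<in>{0..n::nat}. U i \<subseteq> V1 G" "card (U 0) = 1"
      using assms(3) unfolding left_cut_percolating_def by blast
    then have "U 0 \<noteq> {}" "U 0 \<subseteq> V1 G" by auto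
    then show ?thesis using assms(1) by (auto simp: bigraph_def card_gt_0_iff)
  qed
  have nonneg: "0 \<le> density G (\<lambda>_. d)" for d by (rule density_nonneg[OF assms(1)])
  \<comment> \<open>Adding \<epsilon> keeps the bounds positive even where a constant coloring has
    density 0.\<close>
  have le: "density G l \<le> (\<Prod>v\<in>V1 G. (density G (\<lambda>_. l v) + \<epsilon>) powr (1 / ?n))" if "0 < \<epsilon>" for \<epsilon>
  proof (rule density_le_prod[OF assms(1-3) inv])
    fix d
    have pos: "0 < density G (\<lambda>_. d) + \<epsilon>" using nonneg[of d] that by simp
    then show "0 < (density G (\<lambda>_. d) + \<epsilon>) powr (1 / ?n)" by simp
    have "((density G (\<lambda>_. d) + \<epsilon>) powr (1 / ?n)) ^ ?n = density G (\<lambda>_. d) + \<epsilon>"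
      using n pos by (simp add: powr_powr flip: powr_realpow)
    then show "density G (\<lambda>_. d) \<le> ((density G (\<lambda>_. d) + \<epsilon>) powr (1 / ?n)) ^ ?n"
      using that by simp
  qed
  have "density G l \<le> (\<Prod>v\<in>V1 G. density G (\<lambda>_. l v) powr (1 / ?n))"
  proof (rule tendsto_lowerbound)
    have "((\<lambda>\<epsilon>. density G (\<lambda>_. l v) + \<epsilon>) \<longlongrightarrow> density G (\<lambda>_. l v)) (at_right 0)" for v
      by (auto intro!: tendsto_eq_intros)
    \<comment> \<open>If the limiting base is 0, convergence of \<open>powr\<close> requires
      eventually nonnegative bases and a positive limit exponent.\<close>
    moreover have "\<forall>\<^sub>F \<epsilon> in at_right 0. 0 \<le> density G (\<lambda>_. l v) + \<epsilon>" for v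
      using eventually_at_right_less[of "0 :: real"]
      by eventually_elim (use nonneg[of "l v"] in simp)
    ultimately show "((\<lambda>\<epsilon>. \<Prod>v\<in>V1 G. (density G (\<lambda>_. l v) + \<epsilon>) powr (1 / ?n)) \<longlongrightarrow>
        (\<Prod>v\<in>V1 G. density G (\<lambda>_. l v) powr (1 / ?n))) (at_right 0)"
      using n by (intro tendsto_prod tendsto_powr') auto
    show "\<forall>\<^sub>F \<epsilon> in at_right 0.
        density G l \<le> (\<Prod>v\<in>V1 G. (density G (\<lambda>_. l v) + \<epsilon>) powr (1 / ?n))"
      using eventually_at_right_less[of "0 :: real"] by eventually_elim (rule le)
  qed simp
  then show "hom_density M N G (left_tensor l c) W
      \<le> (\<Prod>v\<in>V1 G. hom_density M N G (left_tensor (\<lambda>_. l v) c) W powr (1 / real ?n))"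
    by (simp add: hom_density_left_tensor[OF assms(1)])
qed

end
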